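(* The equation $x+y+z=1$ with $x,y,z\in\mathcal{B}_{2,1}$ and $x\le y\le z$ has exactly two solutions: $$x=2-\sqrt3=[3,\overline{1,2}],\quad y=z=\frac{\sqrt3-1}{2}=[\overline{2,1}],$$ and $$x=y=\frac{2-\sqrt2}{2}=[3,\overline{2}],\quad z=\sqrt2-1=[\overline{2}].$$
   Context: For irrational $x\in(0,1)$, $x=[a_1(x),a_2(x),\dots]$ denotes its simple continued fraction expansion; an overline denotes a periodically repeated block. For a positive integer $B$ and $j\ge0$, $\mathcal{B}_{B,j}$ is the set of irrational $x\in(0,1)$ with $a_k(x)\le B+1$ for all $k\le j$ and $a_k(x)\le B$ for all $k>j$. Thus $\mathcal{B}_{2,1}$ consists of the irrationals $x\in(0,1)$ with $a_1(x)\le3$ and $a_k(x)\le2$ for all $k\ge2$. *)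

theory Defs
  imports Complex_Main
begin

text \<open>Gauss map T(x) = {1/x}; for irrational x in (0,1), the k-th partial quotient
  (k \<ge> 1) of x = [a_1, a_2, ...] = 1/(a_1 + 1/(a_2 + ...)) is floor(1 / T^(k-1)(x)).\<close>

definition gauss_map :: "real \<Rightarrow> real" where
  "gauss_map x = frac (1 / x)"

definition cf_digit :: "real \<Rightarrow> nat \<Rightarrow> int" where
  "cf_digit x k = \<lfloor>1 / (gauss_map ^^ (k - 1)) x\<rfloor>"

definition bounded_cf :: "nat \<Rightarrow> nat \<Rightarrow> real set" where
  "bounded_cf B j = {x. 0 < x \<and> x < 1 \<and> x \<notin> \<rat> \<and>
      (\<forall>k. 1 \<le> k \<and> k \<le> j \<longrightarrow> cf_digit x k \<le> int B + 1) \<and>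
      (\<forall>k. j < k \<longrightarrow> cf_digit x k \<le> int B)}"

end

theory Submission
  imports Defs "HOL-Computational_Algebra.Primes"
begin

text \<open>Every element of \<open>\<B>\<^sub>2\<^sub>,\<^sub>1\<close> is \<open>1/(a + s)\<close> with \<open>a \<in> {1,2,3}\<close> and \<open>s \<in> \<B>\<^sub>2\<^sub>,\<^sub>0\<close>,
  and \<open>\<B>\<^sub>2\<^sub>,\<^sub>0\<close> lies between \<open>\<alpha> = [2,1,2,1,\<dots>] = (\<surd>3 - 1)/2\<close> and
  \<open>\<beta> = [1,2,1,2,\<dots>] = \<surd>3 - 1\<close>. These crude bounds leave only the leading digits
  \<open>(3,2,2)\<close>, which force the first solution, and \<open>(3,3,2)\<close>, i.e. \<open>x = 1/(3+s)\<close>,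
  \<open>y = 1/(3+t)\<close>, \<open>z = 1/(2+u)\<close>. In the Moebius coordinate \<open>\<rho>\<close> that sends the fixed
  points \<open>\<omega> = \<surd>2 - 1\<close> and \<open>-(\<surd>2 + 1)\<close> of \<open>w \<mapsto> 1/(2+w)\<close> to \<open>0\<close> and \<open>\<infinity>\<close>, this map
  becomes multiplication by \<open>-\<kappa>\<close>, \<open>\<kappa> = 3 - 2\<surd>2\<close>, and the equation becomes a member
  of a one-parameter family of equations, all of whose solutions have leading digits \<open>2\<close>.
  The Gauss map carries the family into itself while dividing \<open>\<rho>\<close> by \<open>-\<kappa>\<close>; as \<open>|\<rho>| \<le> 1\<close>,
  iterating gives \<open>\<rho>(s) = \<rho>(t) = \<rho>(u) = 0\<close>, that is \<open>s = t = u = \<omega>\<close>.\<close>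

lemma sqrt_prime_irrational:
  fixes p :: nat
  assumes "prime p"
  shows "sqrt p \<notin> \<rat>"
proof
  from \<open>prime p\<close> have p: "p > 1" by (rule prime_gt_1_nat)
  assume "sqrt p \<in> \<rat>"
  then obtain m n :: nat
    where n: "n \<noteq> 0" and sqrt_rat: "\<bar>sqrt p\<bar> = m / n" and "coprime m n"
    by (rule Rats_abs_nat_div_natE)
  have eq: "m\<^sup>2 = p * n\<^sup>2"
  proof -
    from n and sqrt_rat have "m = \<bar>sqrt p\<bar> * n" by simp
    then have "m\<^sup>2 = (sqrt p)\<^sup>2 * n\<^sup>2" by (simp add: power_mult_distrib)
    also have "(sqrt p)\<^sup>2 = p" by simp
    also have "\<dots> * n\<^sup>2 = p * n\<^sup>2" by simp
    finally show ?thesis by linarith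
  qed
  have "p dvd m \<and> p dvd n"
  proof
    from eq have "p dvd m\<^sup>2" ..
    with \<open>prime p\<close> show "p dvd m" by (rule prime_dvd_power)
    then obtain k where "m = p * k" ..
    with eq have "p * n\<^sup>2 = p\<^sup>2 * k\<^sup>2" by algebra
    with p have "n\<^sup>2 = p * k\<^sup>2" by (simp add: power2_eq_square)
    then have "p dvd n\<^sup>2" ..
    with \<open>prime p\<close> show "p dvd n" by (rule prime_dvd_power)
  qed
  then have "p dvd gcd m n" by simp
  with \<open>coprime m n\<close> p show False by simp
qed

lemma all_ge_one_split:
  "(\<forall>k\<ge>1. P k) \<longleftrightarrow> P 1 \<and> (\<forall>k\<ge>1. P (Suc k))"
proof (intro iffI allI impI)
  fix k :: nat
  assume split: "P 1 \<and> (\<forall>k\<ge>1. P (Suc k))" and "1 \<le> k"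
  then obtain m where "k = Suc m" by (cases k) auto
  with split show "P k" by (cases "m = 0") auto
qed simp

lemma moebius_diff:
  fixes a b c d p v :: "'a :: field"
  assumes "c * p + d \<noteq> 0" "c * v + d \<noteq> 0"
  shows "(a * p + b) / (c * p + d) - (a * v + b) / (c * v + d)
       = (a * d - b * c) * (p - v) / ((c * p + d) * (c * v + d))"
  using assms by (simp add: field_simps)

lemma nonpos_if_expanding:
  fixes f :: "'a \<Rightarrow> real"
  assumes "1 < c"
    and closed: "\<And>p. p \<in> A \<Longrightarrow> T p \<in> A"
    and bounded: "\<And>p. p \<in> A \<Longrightarrow> f p \<le> M"
    and expanding: "\<And>p. p \<in> A \<Longrightarrow> 0 < f p \<Longrightarrow> c * f p \<le> f (T p)"
    and "p \<in> A"
  shows "f p \<le> 0"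
proof (rule ccontr)
  have iterate: "\<forall>p\<in>A. 0 < f p \<longrightarrow> c ^ n * f p \<le> M" for n
  proof (induction n)
    case 0
    then show ?case using bounded by simp
  next
    case (Suc n)
    show ?case
    proof (intro ballI impI)
      fix p assume p: "p \<in> A" "0 < f p"
      have "c ^ Suc n * f p = c ^ n * (c * f p)" by simp
      also have "\<dots> \<le> c ^ n * f (T p)"
        using expanding[OF p] \<open>1 < c\<close> by (intro mult_left_mono) auto
      also have "\<dots> \<le> M"
        using Suc.IH closed[OF p(1)] expanding[OF p] \<open>1 < c\<close> p(2)
        by (meson less_le_trans mult_pos_pos zero_less_one less_trans)
      finally show "c ^ Suc n * f p \<le> M" .
    qed
  qed
  assume "\<not> f p \<le> 0"
  then have pos: "0 < f p" by simp
  obtain n where "M / f p < c ^ n" using real_arch_pow[OF \<open>1 < c\<close>] by blast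
  then have "M < c ^ n * f p" using pos by (simp add: divide_less_eq)
  with iterate[of n] \<open>p \<in> A\<close> pos show False by auto
qed

lemma gauss_map_eq:
  assumes "0 < x" "1 / x = of_int n + w" "0 \<le> w" "w < 1"
  shows "gauss_map x = w" "\<lfloor>1 / x\<rfloor> = n"
proof -
  show floor: "\<lfloor>1 / x\<rfloor> = n"
    unfolding assms(2) using assms(3,4) by (intro floor_unique) auto
  show "gauss_map x = w"
    unfolding gauss_map_def frac_def floor using assms(2) by simp
qed

lemma inverse_floor_add_gauss_map:
  "x \<noteq> 0 \<Longrightarrow> x = 1 / (of_int \<lfloor>1 / x\<rfloor> + gauss_map x)"
  by (simp add: gauss_map_def frac_def)

lemma gauss_map_unit_irrational:
  assumes "0 < x" "x < 1" "x \<notin> \<rat>"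
  shows "0 < gauss_map x" "gauss_map x < 1" "gauss_map x \<notin> \<rat>"
proof -
  have "1 / x \<notin> \<rat>"
  proof
    assume "1 / x \<in> \<rat>"
    then have "1 / (1 / x) \<in> \<rat>" by (rule Rats_divide[OF Rats_1])
    with assms show False by simp
  qed
  then show "gauss_map x \<notin> \<rat>"
    by (simp add: gauss_map_def)
  then have "gauss_map x \<noteq> 0" by auto
  then show "0 < gauss_map x" by (simp add: gauss_map_def order_less_le)
  show "gauss_map x < 1" by (simp add: gauss_map_def frac_lt_1)
qed

lemma cf_digit_1: "cf_digit x 1 = \<lfloor>1 / x\<rfloor>"
  by (simp add: cf_digit_def)

lemma cf_digit_Suc: "1 \<le> k \<Longrightarrow> cf_digit x (Suc k) = cf_digit (gauss_map x) k"
  by (cases k) (auto simp: cf_digit_def funpow_swap1)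

lemma bounded_cf_altdef:
  "bounded_cf B j = {x. 0 < x \<and> x < 1 \<and> x \<notin> \<rat> \<and>
     (\<forall>k\<ge>1. cf_digit x k \<le> int B + (if k \<le> j then 1 else 0))}"
proof -
  have "(\<forall>k. 1 \<le> k \<and> k \<le> j \<longrightarrow> cf_digit x k \<le> int B + 1) \<and> (\<forall>k. j < k \<longrightarrow> cf_digit x k \<le> int B)
    \<longleftrightarrow> (\<forall>k\<ge>1. cf_digit x k \<le> int B + (if k \<le> j then 1 else 0))" (is "?old \<longleftrightarrow> ?new") for x
  proof
    assume ?old
    then show ?new by (metis add.right_neutral not_le)
  next
    assume new: ?new
    show ?old
    proof (intro conjI allI impI)
      fix k assume "1 \<le> k \<and> k \<le> j"
      then show "cf_digit x k \<le> int B + 1" using new by auto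
    next
      fix k assume "j < k"
      then have "1 \<le> k" "\<not> k \<le> j" by auto
      then show "cf_digit x k \<le> int B" using new by fastforce
    qed
  qed
  then show ?thesis unfolding bounded_cf_def by blast
qed

lemma bounded_cf_unit:
  "x \<in> bounded_cf B j \<Longrightarrow> 0 < x \<and> x < 1"
  by (simp add: bounded_cf_def)

lemma bounded_cf_iff:
  "x \<in> bounded_cf B j \<longleftrightarrow> 0 < x \<and> x < 1 \<and> x \<notin> \<rat> \<and>
     \<lfloor>1 / x\<rfloor> \<le> int B + (if j = 0 then 0 else 1) \<and> gauss_map x \<in> bounded_cf B (j - 1)"
proof (cases "0 < x \<and> x < 1 \<and> x \<notin> \<rat>")
  case True
  let ?bound = "\<lambda>k j. int B + (if k \<le> j then 1 else 0)"
  have shift: "(\<forall>k\<ge>1. cf_digit x (Suc k) \<le> ?bound (Suc k) j) \<longleftrightarrow>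
               (\<forall>k\<ge>1. cf_digit (gauss_map x) k \<le> ?bound k (j - 1))"
    by (intro all_cong1 imp_cong refl) (auto simp: cf_digit_Suc)
  have "(\<forall>k\<ge>1. cf_digit x k \<le> ?bound k j) \<longleftrightarrow>
        \<lfloor>1 / x\<rfloor> \<le> int B + (if j = 0 then 0 else 1) \<and>
        (\<forall>k\<ge>1. cf_digit (gauss_map x) k \<le> ?bound k (j - 1))"
    unfolding all_ge_one_split[where P = "\<lambda>k. cf_digit x k \<le> ?bound k j"] shift cf_digit_1
    by simp
  moreover have "0 < gauss_map x \<and> gauss_map x < 1 \<and> gauss_map x \<notin> \<rat>"
    using gauss_map_unit_irrational True by blast
  ultimately show ?thesis
    using True unfolding bounded_cf_altdef mem_Collect_eq by blast
qed (auto simp: bounded_cf_altdef)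

lemma gauss_map_in_bounded_cf:
  "x \<in> bounded_cf B j \<Longrightarrow> gauss_map x \<in> bounded_cf B (j - 1)"
  using bounded_cf_iff by blast

lemma gauss_map_in_bounded_cf_0:
  "x \<in> bounded_cf B 0 \<Longrightarrow> gauss_map x \<in> bounded_cf B 0"
  using gauss_map_in_bounded_cf by fastforce

lemma bounded_cf_mono:
  assumes "j \<le> j'"
  shows "bounded_cf B j \<subseteq> bounded_cf B j'"
proof
  fix x assume x: "x \<in> bounded_cf B j"
  have "cf_digit x k \<le> int B + (if k \<le> j' then 1 else 0)" if "1 \<le> k" for k
  proof -
    have "cf_digit x k \<le> int B + (if k \<le> j then 1 else 0)"
      using x that by (simp add: bounded_cf_altdef)
    also have "\<dots> \<le> int B + (if k \<le> j' then 1 else 0)"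
      using assms by simp
    finally show ?thesis .
  qed
  with x show "x \<in> bounded_cf B j'" by (simp add: bounded_cf_altdef)
qed

lemma bounded_cf_coinduct:
  assumes "x \<in> S"
    and step: "\<And>w. w \<in> S \<Longrightarrow>
      0 < w \<and> w < 1 \<and> w \<notin> \<rat> \<and> \<lfloor>1 / w\<rfloor> \<le> int B \<and> gauss_map w \<in> S"
  shows "x \<in> bounded_cf B 0"
proof -
  have orbit: "(gauss_map ^^ n) x \<in> S" for n
    by (induction n) (simp_all add: assms)
  have "cf_digit x k \<le> int B" for k
    unfolding cf_digit_def using step[OF orbit] by simp
  then show ?thesis using step[OF \<open>x \<in> S\<close>] by (simp add: bounded_cf_altdef)
qed

lemma bounded_cf_inverse_add:
  assumes w: "w \<in> bounded_cf B (j - 1)"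
    and n: "1 \<le> n" "n \<le> int B + (if j = 0 then 0 else 1)"
  shows "1 / (of_int n + w) \<in> bounded_cf B j"
proof -
  define x where "x = 1 / (of_int n + w)"
  have w_unit: "0 < w" "w < 1" "w \<notin> \<rat>" using w by (auto simp: bounded_cf_def)
  have x_unit: "0 < x" "x < 1" using w_unit n unfolding x_def by auto
  have inv: "1 / x = of_int n + w" using w_unit n unfolding x_def by simp
  have "x \<notin> \<rat>"
  proof
    assume "x \<in> \<rat>"
    then have "1 / x - of_int n \<in> \<rat>" by (intro Rats_diff Rats_divide) auto
    with inv w_unit show False by simp
  qed
  with x_unit gauss_map_eq[OF x_unit(1) inv] w_unit n w show ?thesis
    unfolding x_def[symmetric] by (subst bounded_cf_iff) auto
qed

lemma sqrt3_bounds: "1732 / 1000 < sqrt (3 :: real)" "sqrt (3 :: real) < 17321 / 10000"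
proof -
  show "1732 / 1000 < sqrt (3 :: real)" by (rule real_less_rsqrt) (simp add: power2_eq_square)
  have "sqrt (3 :: real) < sqrt ((17321 / 10000)\<^sup>2)"
    by (subst real_sqrt_less_iff) (simp add: power2_eq_square)
  then show "sqrt (3 :: real) < 17321 / 10000" by simp
qed

lemma sqrt2_bounds: "14142135 / 10000000 < sqrt (2 :: real)" "sqrt (2 :: real) < 14142136 / 10000000"
proof -
  show "14142135 / 10000000 < sqrt (2 :: real)" by (rule real_less_rsqrt) (simp add: power2_eq_square)
  have "sqrt (2 :: real) < sqrt ((14142136 / 10000000)\<^sup>2)"
    by (subst real_sqrt_less_iff) (simp add: power2_eq_square)
  then show "sqrt (2 :: real) < 14142136 / 10000000" by simp
qed

lemma sqrt2_mult_sqrt2: "sqrt 2 * (sqrt 2 * x) = 2 * (x :: real)"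
  by (simp add: mult.assoc[symmetric])

lemma sqrt3_irrational: "sqrt 3 \<notin> \<rat>"
  using sqrt_prime_irrational[of 3] by simp

lemma sqrt2_irrational: "sqrt 2 \<notin> \<rat>"
  using sqrt_prime_irrational[of 2] by simp

definition alpha :: real where "alpha = (sqrt 3 - 1) / 2"
definition beta :: real where "beta = sqrt 3 - 1"
definition omega :: real where "omega = sqrt 2 - 1"

lemma alpha_bounds: "366 / 1000 \<le> alpha" "alpha < 1"
  using sqrt3_bounds by (simp_all add: alpha_def)

lemma beta_bounds: "0 < beta" "beta < 1"
  using sqrt3_bounds by (simp_all add: beta_def)

lemma omega_bounds: "0 < omega" "omega < 1"
  using sqrt2_bounds by (simp_all add: omega_def)

lemma alpha_inverse: "1 / alpha = 2 + beta"
  by (simp add: alpha_def beta_def field_simps)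

lemma beta_inverse: "1 / beta = 1 + alpha"
proof -
  have "(1 + alpha) * beta = 1" by (simp add: alpha_def beta_def field_simps)
  then show ?thesis using beta_bounds by (simp add: field_simps)
qed

lemma omega_inverse: "1 / omega = 2 + omega"
proof -
  have "(2 + omega) * omega = 1" by (simp add: omega_def algebra_simps)
  then show ?thesis using omega_bounds by (simp add: field_simps)
qed

lemma omega_fixed: "1 / (2 + omega) = omega"
  using omega_inverse by (metis inverse_eq_divide inverse_inverse_eq)

lemma two_minus_sqrt3_eq: "2 - sqrt 3 = 1 / (3 + beta)"
proof -
  have "(3 + beta) * (2 - sqrt 3) = 1" by (simp add: beta_def algebra_simps)
  then show ?thesis using beta_bounds by (simp add: field_simps)
qed

lemma half_two_minus_sqrt2_eq: "(2 - sqrt 2) / 2 = 1 / (3 + omega)"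
proof -
  have "(3 + omega) * ((2 - sqrt 2) / 2) = 1" by (simp add: omega_def algebra_simps sqrt2_mult_sqrt2)
  then show ?thesis using omega_bounds by (simp add: field_simps)
qed

lemma alpha_beta_in_bounded_cf: "alpha \<in> bounded_cf 2 0" "beta \<in> bounded_cf 2 0"
proof -
  have "alpha \<notin> \<rat>"
  proof
    assume "alpha \<in> \<rat>"
    moreover have "sqrt 3 = 2 * alpha + 1" by (simp add: alpha_def field_simps)
    ultimately show False using sqrt3_irrational by simp
  qed
  moreover have "beta \<notin> \<rat>"
  proof
    assume "beta \<in> \<rat>"
    moreover have "sqrt 3 = beta + 1" by (simp add: beta_def)
    ultimately show False using sqrt3_irrational by simp
  qed
  moreover have "gauss_map alpha = beta" "gauss_map beta = alpha"
    using gauss_map_eq(1)[of alpha 2 beta] gauss_map_eq(1)[of beta 1 alpha]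
      alpha_inverse beta_inverse alpha_bounds beta_bounds by simp_all
  ultimately have orbit: "\<And>w. w \<in> {alpha, beta} \<Longrightarrow>
      0 < w \<and> w < 1 \<and> w \<notin> \<rat> \<and> \<lfloor>1 / w\<rfloor> \<le> int 2 \<and> gauss_map w \<in> {alpha, beta}"
    using alpha_bounds beta_bounds alpha_inverse beta_inverse by auto
  show "alpha \<in> bounded_cf 2 0" by (rule bounded_cf_coinduct[OF _ orbit]) simp
  show "beta \<in> bounded_cf 2 0" by (rule bounded_cf_coinduct[OF _ orbit]) simp
qed

lemma omega_in_bounded_cf: "omega \<in> bounded_cf 2 0"
proof (rule bounded_cf_coinduct[where S = "{omega}"])
  have "omega \<notin> \<rat>"
  proof
    assume "omega \<in> \<rat>"
    moreover have "sqrt 2 = omega + 1" by (simp add: omega_def)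
    ultimately show False using sqrt2_irrational by simp
  qed
  moreover have "gauss_map omega = omega"
    using gauss_map_eq(1)[of omega 2 omega] omega_inverse omega_bounds by simp
  ultimately show "\<And>w. w \<in> {omega} \<Longrightarrow>
      0 < w \<and> w < 1 \<and> w \<notin> \<rat> \<and> \<lfloor>1 / w\<rfloor> \<le> int 2 \<and> gauss_map w \<in> {omega}"
    using omega_bounds omega_inverse by auto
qed simp

lemma bounded_cf_2_0_cases:
  assumes "w \<in> bounded_cf 2 0"
  shows "w = 1 / (1 + gauss_map w) \<or> w = 1 / (2 + gauss_map w)"
proof -
  have w: "0 < w" "w < 1" "w \<notin> \<rat>" "\<lfloor>1 / w\<rfloor> \<le> 2"
    using assms bounded_cf_iff[of w 2 0] by simp_all
  then have "1 < 1 / w" by simp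
  with w have "\<lfloor>1 / w\<rfloor> = 1 \<or> \<lfloor>1 / w\<rfloor> = 2" by linarith
  then show ?thesis using inverse_floor_add_gauss_map[of w] w by auto
qed

lemma bounded_cf_2_0_between:
  assumes "w \<in> bounded_cf 2 0"
  shows "1 / (2 + gauss_map w) \<le> w" "w \<le> 1 / (1 + gauss_map w)"
proof -
  have "0 < gauss_map w"
    using bounded_cf_unit gauss_map_in_bounded_cf_0 assms by fastforce
  then have "1 / (2 + gauss_map w) \<le> 1 / (1 + gauss_map w)"
    by (intro divide_left_mono) auto
  then show "1 / (2 + gauss_map w) \<le> w" "w \<le> 1 / (1 + gauss_map w)"
    using bounded_cf_2_0_cases[OF assms] by auto
qed

lemma inverse_two_add_inverse_one_add:
  "0 \<le> v \<Longrightarrow> 1 / (2 + 1 / (1 + v)) = (v + 1) / (2 * v + 3 :: real)"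
  by (simp add: field_simps)

lemma inverse_one_add_inverse_two_add:
  "0 \<le> v \<Longrightarrow> 1 / (1 + 1 / (2 + v)) = (v + 2) / (v + 3 :: real)"
  by (simp add: field_simps)

lemma bounded_cf_2_0_two_step:
  assumes "w \<in> bounded_cf 2 0" and v: "v = gauss_map (gauss_map w)"
  shows "(v + 1) / (2 * v + 3) \<le> w" "w \<le> (v + 2) / (v + 3)"
proof -
  define g where "g = gauss_map w"
  have g: "g \<in> bounded_cf 2 0" using gauss_map_in_bounded_cf_0[OF assms(1)] by (simp add: g_def)
  have v_pos: "0 < v" using bounded_cf_unit gauss_map_in_bounded_cf_0[OF g] by (simp add: v g_def)
  have g_pos: "0 < g" using bounded_cf_unit[OF g] by simp
  have "(v + 1) / (2 * v + 3) = 1 / (2 + 1 / (1 + v))"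
    using v_pos by (simp add: inverse_two_add_inverse_one_add)
  also have "\<dots> \<le> 1 / (2 + g)"
    using bounded_cf_2_0_between(2)[OF g] g_pos v_pos
    by (intro divide_left_mono add_left_mono) (auto simp: g_def v intro!: mult_pos_pos add_pos_pos)
  also have "\<dots> \<le> w" using bounded_cf_2_0_between(1)[OF assms(1)] by (simp add: g_def)
  finally show "(v + 1) / (2 * v + 3) \<le> w" .
  have "w \<le> 1 / (1 + g)" using bounded_cf_2_0_between(2)[OF assms(1)] by (simp add: g_def)
  also have "\<dots> \<le> 1 / (1 + 1 / (2 + v))"
    using bounded_cf_2_0_between(1)[OF g] g_pos v_pos
    by (intro divide_left_mono add_left_mono) (auto simp: g_def v intro!: mult_pos_pos add_pos_pos)
  also have "\<dots> = (v + 2) / (v + 3)"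
    using v_pos by (simp add: inverse_one_add_inverse_two_add)
  finally show "w \<le> (v + 2) / (v + 3)" .
qed

text \<open>Two steps of the Gauss map multiply the distance to \<open>alpha\<close> (resp. \<open>beta\<close>), the fixed point
  of the Moebius map in \<open>bounded_cf_2_0_two_step\<close>, by at least \<open>9\<close>: that map has determinant \<open>1\<close>
  and its denominator exceeds \<open>3\<close> on positive arguments.\<close>

lemma bounded_cf_2_0_ge_alpha:
  assumes "w \<in> bounded_cf 2 0"
  shows "alpha \<le> w"
proof -
  have alpha_fixed: "alpha = (alpha + 1) / (2 * alpha + 3)"
  proof -
    have "alpha = 1 / (2 + beta)" "beta = 1 / (1 + alpha)"
      using alpha_inverse beta_inverse by (metis inverse_eq_divide inverse_inverse_eq)+
    then have "alpha = 1 / (2 + 1 / (1 + alpha))" by simp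
    then show ?thesis using alpha_bounds by (simp add: inverse_two_add_inverse_one_add)
  qed
  have "alpha - w \<le> 0"
  proof (rule nonpos_if_expanding[where c = 9 and M = 1 and T = "gauss_map \<circ> gauss_map"
      and f = "\<lambda>w. alpha - w" and A = "bounded_cf 2 0"])
    fix w assume w: "w \<in> bounded_cf 2 0"
    then show "(gauss_map \<circ> gauss_map) w \<in> bounded_cf 2 0"
      by (simp add: gauss_map_in_bounded_cf_0)
    show "alpha - w \<le> 1" using alpha_bounds bounded_cf_unit[OF w] by simp
    assume gap: "0 < alpha - w"
    define v where "v = gauss_map (gauss_map w)"
    have v_pos: "0 < v"
      using bounded_cf_unit[OF gauss_map_in_bounded_cf_0[OF gauss_map_in_bounded_cf_0[OF w]]]
      by (simp add: v_def)
    define D where "D = (2 * alpha + 3) * (2 * v + 3)"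
    have D: "9 \<le> D"
      using alpha_bounds v_pos unfolding D_def by (simp add: algebra_simps)
    have "alpha - w \<le> (alpha + 1) / (2 * alpha + 3) - (v + 1) / (2 * v + 3)"
      using bounded_cf_2_0_two_step(1)[OF w v_def] alpha_fixed by linarith
    also have "\<dots> = (alpha - v) / D"
      using moebius_diff[of 2 alpha 3 v 1 1] alpha_bounds v_pos by (simp add: D_def)
    finally have "D * (alpha - w) \<le> alpha - v"
      using D by (simp add: pos_le_divide_eq mult.commute)
    moreover have "9 * (alpha - w) \<le> D * (alpha - w)"
      using D gap by (intro mult_right_mono) auto
    ultimately show "9 * (alpha - w) \<le> alpha - (gauss_map \<circ> gauss_map) w"
      by (simp add: v_def)
  qed (use assms in simp_all)
  then show ?thesis by simp
qed

lemma bounded_cf_2_0_le_beta: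
  assumes "w \<in> bounded_cf 2 0"
  shows "w \<le> beta"
proof -
  have beta_fixed: "beta = (beta + 2) / (beta + 3)"
  proof -
    have "alpha = 1 / (2 + beta)" "beta = 1 / (1 + alpha)"
      using alpha_inverse beta_inverse by (metis inverse_eq_divide inverse_inverse_eq)+
    then have "beta = 1 / (1 + 1 / (2 + beta))" by simp
    then show ?thesis using beta_bounds by (simp add: inverse_one_add_inverse_two_add)
  qed
  have "w - beta \<le> 0"
  proof (rule nonpos_if_expanding[where c = 9 and M = 1 and T = "gauss_map \<circ> gauss_map"
      and f = "\<lambda>w. w - beta" and A = "bounded_cf 2 0"])
    fix w assume w: "w \<in> bounded_cf 2 0"
    then show "(gauss_map \<circ> gauss_map) w \<in> bounded_cf 2 0"
      by (simp add: gauss_map_in_bounded_cf_0)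
    show "w - beta \<le> 1" using beta_bounds bounded_cf_unit[OF w] by simp
    assume gap: "0 < w - beta"
    define v where "v = gauss_map (gauss_map w)"
    have v_pos: "0 < v"
      using bounded_cf_unit[OF gauss_map_in_bounded_cf_0[OF gauss_map_in_bounded_cf_0[OF w]]]
      by (simp add: v_def)
    define D where "D = (v + 3) * (beta + 3)"
    have D: "9 \<le> D"
      using beta_bounds v_pos unfolding D_def by (simp add: algebra_simps)
    have "w - beta \<le> (v + 2) / (v + 3) - (beta + 2) / (beta + 3)"
      using bounded_cf_2_0_two_step(2)[OF w v_def] beta_fixed by linarith
    also have "\<dots> = (v - beta) / D"
      using moebius_diff[of 1 v 3 beta 1 2] beta_bounds v_pos by (simp add: D_def)
    finally have "D * (w - beta) \<le> v - beta"
      using D by (simp add: pos_le_divide_eq mult.commute)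
    moreover have "9 * (w - beta) \<le> D * (w - beta)"
      using D gap by (intro mult_right_mono) auto
    ultimately show "9 * (w - beta) \<le> (gauss_map \<circ> gauss_map) w - beta"
      by (simp add: v_def)
  qed (use assms in simp_all)
  then show ?thesis by simp
qed

text \<open>\<open>rho\<close> sends the fixed points \<open>omega\<close> and \<open>-(sqrt 2 + 1)\<close> of \<open>w \<mapsto> 1/(2 + w)\<close> to \<open>0\<close> and
  \<open>\<infinity>\<close>, so it conjugates that map to multiplication by \<open>- kappa\<close> (lemma \<open>rho_gauss_step\<close>).
  By \<open>sum_eq_one_minus_defect\<close>, \<open>1/(3+s) + 1/(3+t) + 1/(2+u) = 1\<close> says \<open>defect kappa s t u = 0\<close>;
  the parameter \<open>\<mu>\<close> absorbs the powers of \<open>- kappa\<close> produced by the Gauss map.\<close>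

definition rho :: "real \<Rightarrow> real" where
  "rho w = (w - omega) / (w + sqrt 2 + 1)"

definition kappa :: real where
  "kappa = 3 - 2 * sqrt 2"

definition phi :: "real \<Rightarrow> real \<Rightarrow> real" where
  "phi \<mu> X = X / (1 - \<mu> * X)"

definition defect :: "real \<Rightarrow> real \<Rightarrow> real \<Rightarrow> real \<Rightarrow> real" where
  "defect \<mu> s t u = phi \<mu> (rho s) + phi \<mu> (rho t) + 2 * phi (- \<mu>) (rho u)"

lemma kappa_bounds: "1715 / 10000 < kappa" "kappa < 1716 / 10000"
  using sqrt2_bounds by (simp_all add: kappa_def)

lemma rho_denominator_pos: "0 \<le> w \<Longrightarrow> 0 < w + sqrt 2 + 1"
  using sqrt2_bounds by linarith

lemma rho_gauss_step:
  assumes "0 \<le> w"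
  shows "rho (1 / (2 + w)) = - kappa * rho w"
proof -
  have "0 \<le> (sqrt 2 + 1) * (2 + w)" using assms by simp
  then have pos: "0 < w + sqrt 2 + 1" "0 < 1 + (sqrt 2 + 1) * (2 + w)"
    using rho_denominator_pos[OF assms] by linarith+
  have "1 / (2 + w) - omega = (1 - omega * (2 + w)) / (2 + w)"
       "1 / (2 + w) + sqrt 2 + 1 = (1 + (sqrt 2 + 1) * (2 + w)) / (2 + w)"
    using assms by (simp_all add: field_simps)
  then have "rho (1 / (2 + w)) = (1 - omega * (2 + w)) / (1 + (sqrt 2 + 1) * (2 + w))"
    using assms by (simp add: rho_def)
  also have "\<dots> = - kappa * (w - omega) / (w + sqrt 2 + 1)"
    using pos by (simp add: frac_eq_eq kappa_def omega_def algebra_simps sqrt2_mult_sqrt2)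
  finally show ?thesis by (simp add: rho_def)
qed

lemma phi_scale: "phi \<mu> (k * X) = k * phi (k * \<mu>) X"
  by (simp add: phi_def ac_simps)

lemma phi_divide: "D \<noteq> 0 \<Longrightarrow> D - \<mu> * N \<noteq> 0 \<Longrightarrow> phi \<mu> (N / D) = N / (D - \<mu> * N)"
  by (simp add: phi_def field_simps)

lemma defect_gauss_step:
  assumes "0 \<le> s" "0 \<le> t" "0 \<le> u"
  shows "defect \<mu> (1 / (2 + s)) (1 / (2 + t)) (1 / (2 + u)) = - kappa * defect (- kappa * \<mu>) s t u"
proof -
  have "phi \<nu> (rho (1 / (2 + w))) = - kappa * phi (- kappa * \<nu>) (rho w)" if "0 \<le> w" for \<nu> w
    using phi_scale[of \<nu> "- kappa"] by (simp add: rho_gauss_step that)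
  then show ?thesis
    using assms by (simp add: defect_def algebra_simps)
qed

lemma phi_kappa_rho:
  assumes "0 \<le> w"
  shows "phi kappa (rho w) = (w - omega) / (2 * omega * (w + 3))"
proof -
  have denominator: "w + sqrt 2 + 1 - kappa * (w - omega) = 2 * omega * (w + 3)"
    by (simp add: kappa_def omega_def algebra_simps sqrt2_mult_sqrt2)
  have "0 < 2 * omega * (w + 3)" using assms omega_bounds by simp
  then show ?thesis
    using phi_divide[of "w + sqrt 2 + 1" kappa "w - omega"] rho_denominator_pos[OF assms]
    by (simp only: rho_def denominator)
qed

lemma phi_minus_kappa_rho:
  assumes "0 \<le> w"
  shows "phi (- kappa) (rho w) = (w - omega) / ((4 - 2 * sqrt 2) * (w + 2))"
proof -
  have denominator: "w + sqrt 2 + 1 - (- kappa) * (w - omega) = (4 - 2 * sqrt 2) * (w + 2)"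
    by (simp add: kappa_def omega_def algebra_simps sqrt2_mult_sqrt2)
  have "0 < (4 - 2 * sqrt 2) * (w + 2)" using assms sqrt2_bounds by simp
  then show ?thesis
    using phi_divide[of "w + sqrt 2 + 1" "- kappa" "w - omega"] rho_denominator_pos[OF assms]
    by (simp only: rho_def denominator)
qed

lemma inverse_three_add_eq:
  assumes "0 \<le> w"
  shows "1 / (3 + w) = (2 - sqrt 2) / 2 - (3 * sqrt 2 - 4) * phi kappa (rho w)"
proof -
  have nonzero: "2 * omega * (w + 3) \<noteq> 0" using assms omega_bounds by simp
  have "(3 * sqrt 2 - 4) * ((w - omega) / (2 * omega * (w + 3)))
      = (3 * sqrt 2 - 4) * (w - omega) / (2 * omega * (w + 3))" by simp
  also have "\<dots> = ((2 - sqrt 2) * (3 + w) - 2) / (2 * (3 + w))"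
    using assms
    by (subst frac_eq_eq[OF nonzero]) (simp_all add: omega_def algebra_simps sqrt2_mult_sqrt2)
  also have "\<dots> = (2 - sqrt 2) / 2 - 1 / (3 + w)"
    using assms by (simp add: field_simps)
  finally show ?thesis by (simp add: phi_kappa_rho assms)
qed

lemma inverse_two_add_eq:
  assumes "0 \<le> w"
  shows "1 / (2 + w) = omega - 2 * (3 * sqrt 2 - 4) * phi (- kappa) (rho w)"
proof -
  have "0 < 4 - 2 * sqrt 2" using sqrt2_bounds by simp
  then have nonzero: "(4 - 2 * sqrt 2) * (w + 2) \<noteq> 0" using assms by simp
  have "2 * (3 * sqrt 2 - 4) * ((w - omega) / ((4 - 2 * sqrt 2) * (w + 2)))
      = 2 * (3 * sqrt 2 - 4) * (w - omega) / ((4 - 2 * sqrt 2) * (w + 2))" by simp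
  also have "\<dots> = (omega * (2 + w) - 1) / (2 + w)"
    using assms
    by (subst frac_eq_eq[OF nonzero]) (simp_all add: omega_def algebra_simps sqrt2_mult_sqrt2)
  also have "\<dots> = omega - 1 / (2 + w)"
    using assms by (simp add: field_simps)
  finally show ?thesis by (simp add: phi_minus_kappa_rho assms)
qed

lemma sum_eq_one_minus_defect:
  assumes "0 \<le> s" "0 \<le> t" "0 \<le> u"
  shows "1 / (3 + s) + 1 / (3 + t) + 1 / (2 + u) = 1 - (3 * sqrt 2 - 4) * defect kappa s t u"
  unfolding inverse_three_add_eq[OF assms(1)] inverse_three_add_eq[OF assms(2)]
    inverse_two_add_eq[OF assms(3)] defect_def
  by (simp add: omega_def algebra_simps)

lemma rho_abs_le_1:
  assumes "0 \<le> w"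
  shows "\<bar>rho w\<bar> \<le> 1"
proof -
  have "\<bar>w - omega\<bar> \<le> w + sqrt 2 + 1" using assms sqrt2_bounds by (simp add: omega_def abs_le_iff)
  then show ?thesis
    using rho_denominator_pos[OF assms] by (simp add: rho_def abs_divide)
qed

lemma rho_eq_0_iff: "0 \<le> w \<Longrightarrow> rho w = 0 \<longleftrightarrow> w = omega"
  using rho_denominator_pos[of w] by (simp add: rho_def)

lemma rho_ge_of_bounded_cf_2_0:
  assumes "w \<in> bounded_cf 2 0"
  shows "- (1735 / 100000) \<le> rho w"
proof -
  have "366 / 1000 \<le> w" using bounded_cf_2_0_ge_alpha[OF assms] alpha_bounds by linarith
  then have "- (1735 / 100000) * (w + sqrt 2 + 1) \<le> w - omega"
    using sqrt2_bounds unfolding omega_def ring_distribs by linarith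
  then show ?thesis
    using rho_denominator_pos[of w] \<open>366 / 1000 \<le> w\<close> by (simp add: rho_def le_divide_eq)
qed

lemma rho_ge_of_leading_digit_one:
  assumes "w \<in> bounded_cf 2 0" "w = 1 / (1 + gauss_map w)"
  shows "545 / 10000 \<le> rho w"
proof -
  have g: "0 < gauss_map w" "gauss_map w \<le> beta"
    using bounded_cf_unit gauss_map_in_bounded_cf_0[OF assms(1)]
      bounded_cf_2_0_le_beta[OF gauss_map_in_bounded_cf_0[OF assms(1)]] by auto
  then have "1 / (1 + beta) \<le> 1 / (1 + gauss_map w)"
    by (intro divide_left_mono) auto
  then have "1 / (1 + beta) \<le> w" using assms(2) by linarith
  moreover have "57733 / 100000 \<le> 1 / (1 + beta)"
    using sqrt3_bounds by (simp add: beta_def field_simps)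
  ultimately have w: "57733 / 100000 \<le> w" by linarith
  then have "545 / 10000 * (w + sqrt 2 + 1) \<le> w - omega"
    using sqrt2_bounds unfolding omega_def ring_distribs by linarith
  then show ?thesis
    using rho_denominator_pos[of w] w by (simp add: rho_def le_divide_eq)
qed

lemma phi_bounds:
  assumes "\<bar>\<mu>\<bar> \<le> 172 / 1000" "- (1735 / 100000) \<le> X" "X \<le> 1"
  shows "- (175 / 10000) \<le> phi \<mu> X" "545 / 10000 \<le> X \<Longrightarrow> 539 / 10000 \<le> phi \<mu> X"
proof -
  have "\<bar>\<mu> * X\<bar> \<le> 172 / 1000 * \<bar>X\<bar>"
    unfolding abs_mult using assms(1) by (rule mult_right_mono) simp
  moreover have "172 / 1000 * \<bar>X\<bar> \<le> 172 / 1000" using assms(2,3) by simp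
  ultimately have "\<bar>\<mu> * X\<bar> \<le> 172 / 1000" by linarith
  then have den: "0 < 1 - \<mu> * X" by linarith
  show "- (175 / 10000) \<le> phi \<mu> X"
  proof (cases "0 \<le> X")
    case True
    with den have "0 \<le> phi \<mu> X" by (simp add: phi_def)
    then show ?thesis by linarith
  next
    case False
    then have "\<mu> * X \<le> 172 / 1000 * (1735 / 100000)"
      using \<open>\<bar>\<mu> * X\<bar> \<le> 172 / 1000 * \<bar>X\<bar>\<close> assms(2) abs_ge_self[of "\<mu> * X"] by linarith
    then have "- (175 / 10000) * (1 - \<mu> * X) \<le> X"
      using assms(2) unfolding right_diff_distrib by linarith
    with den show ?thesis by (simp add: phi_def le_divide_eq)
  qed
  assume "545 / 10000 \<le> X"
  moreover have "- (172 / 1000) * X \<le> \<mu> * X"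
    using \<open>545 / 10000 \<le> X\<close> assms(1) by (intro mult_right_mono) auto
  ultimately have "539 / 10000 * (1 - \<mu> * X) \<le> X" by (simp add: algebra_simps)
  with den show "539 / 10000 \<le> phi \<mu> X" by (simp add: phi_def le_divide_eq)
qed

lemma leading_digit_two_of_rho_small:
  assumes "w \<in> bounded_cf 2 0" "rho w < 545 / 10000"
  shows "w = 1 / (2 + gauss_map w)"
  using bounded_cf_2_0_cases[OF assms(1)] rho_ge_of_leading_digit_one[OF assms(1)] assms(2)
  by fastforce

lemma defect_zero_imp_rho_small:
  assumes "\<bar>\<mu>\<bar> \<le> kappa"
    and s: "s \<in> bounded_cf 2 0" and t: "t \<in> bounded_cf 2 0" and u: "u \<in> bounded_cf 2 0"
    and zero: "defect \<mu> s t u = 0"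
  shows "rho s < 545 / 10000" "rho t < 545 / 10000" "rho u < 545 / 10000"
proof -
  have \<mu>: "\<bar>\<mu>\<bar> \<le> 172 / 1000" "\<bar>- \<mu>\<bar> \<le> 172 / 1000" using assms(1) kappa_bounds by simp_all
  have range: "- (1735 / 100000) \<le> rho w" "rho w \<le> 1" if "w \<in> bounded_cf 2 0" for w
    using rho_ge_of_bounded_cf_2_0[OF that] rho_abs_le_1[of w] bounded_cf_unit[OF that] by auto
  have lower: "- (175 / 10000) \<le> phi \<nu> (rho w)"
    if "w \<in> bounded_cf 2 0" "\<bar>\<nu>\<bar> \<le> 172 / 1000" for w \<nu>
    using phi_bounds(1)[OF that(2) range[OF that(1)]] .
  have upper: "539 / 10000 \<le> phi \<nu> (rho w)"
    if "w \<in> bounded_cf 2 0" "\<bar>\<nu>\<bar> \<le> 172 / 1000" "\<not> rho w < 545 / 10000" for w \<nu>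
    using phi_bounds(2)[OF that(2) range[OF that(1)]] that(3) by simp
  note sum = zero[unfolded defect_def]
  show "rho s < 545 / 10000"
    using upper[OF s \<mu>(1)] lower[OF t \<mu>(1)] lower[OF u \<mu>(2)] sum by linarith
  show "rho t < 545 / 10000"
    using upper[OF t \<mu>(1)] lower[OF s \<mu>(1)] lower[OF u \<mu>(2)] sum by linarith
  show "rho u < 545 / 10000"
    using upper[OF u \<mu>(2)] lower[OF s \<mu>(1)] lower[OF t \<mu>(1)] sum by linarith
qed

lemma defect_zero_gauss_step:
  assumes "\<bar>\<mu>\<bar> \<le> kappa"
    and s: "s \<in> bounded_cf 2 0" and t: "t \<in> bounded_cf 2 0" and u: "u \<in> bounded_cf 2 0"
    and zero: "defect \<mu> s t u = 0"
  shows "defect (- kappa * \<mu>) (gauss_map s) (gauss_map t) (gauss_map u) = 0"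
    and "rho s = - kappa * rho (gauss_map s)" "rho t = - kappa * rho (gauss_map t)"
    and "rho u = - kappa * rho (gauss_map u)"
proof -
  note small = defect_zero_imp_rho_small[OF assms]
  define s' t' u' where "s' = gauss_map s" "t' = gauss_map t" "u' = gauss_map u"
  have nonneg: "0 \<le> s'" "0 \<le> t'" "0 \<le> u'"
    using bounded_cf_unit gauss_map_in_bounded_cf_0 s t u
    unfolding s'_t'_u'_def by (meson less_imp_le)+
  have digits: "s = 1 / (2 + s')" "t = 1 / (2 + t')" "u = 1 / (2 + u')"
    using leading_digit_two_of_rho_small small s t u unfolding s'_t'_u'_def by blast+
  have "- kappa * defect (- kappa * \<mu>) s' t' u' = 0"
    using zero defect_gauss_step[OF nonneg] by (simp only: digits)
  then show "defect (- kappa * \<mu>) s' t' u' = 0" using kappa_bounds by simp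
  show "rho s = - kappa * rho s'" "rho t = - kappa * rho t'" "rho u = - kappa * rho u'"
    using rho_gauss_step nonneg by (simp_all only: digits)
qed

lemma defect_zero_imp_omega:
  assumes s: "s \<in> bounded_cf 2 0" and t: "t \<in> bounded_cf 2 0" and u: "u \<in> bounded_cf 2 0"
    and zero: "defect kappa s t u = 0"
  shows "s = omega \<and> t = omega \<and> u = omega"
proof -
  define A where "A = {(\<mu>, s, t, u). \<bar>\<mu>\<bar> \<le> kappa \<and> s \<in> bounded_cf 2 0 \<and>
    t \<in> bounded_cf 2 0 \<and> u \<in> bounded_cf 2 0 \<and> defect \<mu> s t u = 0}"
  define T where "T = (\<lambda>(\<mu>, s, t, u). (- kappa * \<mu>, gauss_map s, gauss_map t, gauss_map u))"
  define f :: "real \<times> real \<times> real \<times> real \<Rightarrow> real"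
    where "f = (\<lambda>(\<mu>, s, t, u). max \<bar>rho s\<bar> (max \<bar>rho t\<bar> \<bar>rho u\<bar>))"
  have "f (kappa, s, t, u) \<le> 0"
  proof (rule nonpos_if_expanding[where c = "1 / kappa" and M = 1 and A = A and T = T])
    show "1 < 1 / kappa" using kappa_bounds by simp
    fix p assume "p \<in> A"
    then obtain \<mu> s t u where p: "p = (\<mu>, s, t, u)" and \<mu>: "\<bar>\<mu>\<bar> \<le> kappa"
      and stu: "s \<in> bounded_cf 2 0" "t \<in> bounded_cf 2 0" "u \<in> bounded_cf 2 0"
      and zero: "defect \<mu> s t u = 0"
      unfolding A_def by auto
    note step = defect_zero_gauss_step[OF \<mu> stu zero]
    have "\<bar>- kappa * \<mu>\<bar> \<le> kappa"
      using \<mu> kappa_bounds mult_left_le[of "\<bar>\<mu>\<bar>" kappa] by (simp add: abs_mult)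
    with step(1) stu show "T p \<in> A"
      by (simp add: A_def T_def p gauss_map_in_bounded_cf_0)
    show "f p \<le> 1"
      using rho_abs_le_1 bounded_cf_unit stu by (simp add: f_def p less_imp_le)
    have "1 / kappa * f p = f (T p)"
      using kappa_bounds
      by (simp add: f_def T_def p step(2-4) max_mult_distrib_left abs_mult)
    then show "1 / kappa * f p \<le> f (T p)" by simp
  qed (use assms kappa_bounds in \<open>simp add: A_def\<close>)
  then show ?thesis
    using rho_eq_0_iff bounded_cf_unit assms by (fastforce simp: f_def less_imp_le)
qed

lemma bounded_cf_2_1_cases:
  assumes "x \<in> bounded_cf 2 1"
  obtains (one) "577 / 1000 \<le> x"
    | (two) "alpha \<le> x" "x = 1 / (2 + gauss_map x)"
    | (three) "2 - sqrt 3 \<le> x" "x \<le> 2972 / 10000" "x = 1 / (3 + gauss_map x)"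
proof -
  have x: "0 < x" "x < 1" "\<lfloor>1 / x\<rfloor> \<le> 3" and s: "gauss_map x \<in> bounded_cf 2 0"
    using assms bounded_cf_iff[of x 2 1] by auto
  define s where "s = gauss_map x"
  have s_bounds: "alpha \<le> s" "s \<le> beta"
    using bounded_cf_2_0_ge_alpha[OF s] bounded_cf_2_0_le_beta[OF s] by (simp_all add: s_def)
  have "1 < 1 / x" using x by simp
  then have "\<lfloor>1 / x\<rfloor> = 1 \<or> \<lfloor>1 / x\<rfloor> = 2 \<or> \<lfloor>1 / x\<rfloor> = 3" using x(3) by linarith
  then consider "x = 1 / (1 + s)" | "x = 1 / (2 + s)" | "x = 1 / (3 + s)"
    using inverse_floor_add_gauss_map[of x] x(1) by (auto simp: s_def)
  then show ?thesis
  proof cases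
    case 1
    have "57733 / 100000 \<le> 1 / (1 + beta)"
      using sqrt3_bounds by (simp add: beta_def field_simps)
    also have "\<dots> \<le> 1 / (1 + s)"
      using s_bounds alpha_bounds by (intro divide_left_mono) auto
    finally show ?thesis using 1 by (intro one) simp
  next
    case 2
    have "alpha = 1 / (2 + beta)"
      using alpha_inverse by (metis inverse_eq_divide inverse_inverse_eq)
    also have "\<dots> \<le> 1 / (2 + s)"
      using s_bounds alpha_bounds by (intro divide_left_mono) auto
    finally have "alpha \<le> x" using 2 by simp
    from this 2 show ?thesis unfolding s_def by (rule two)
  next
    case 3
    have "1 / (3 + beta) \<le> 1 / (3 + s)" "1 / (3 + s) \<le> 1 / (3 + alpha)"
      using s_bounds alpha_bounds by (intro divide_left_mono; simp)+
    then have "2 - sqrt 3 \<le> x" "x \<le> 1 / (3 + alpha)"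
      using 3 by (simp_all add: two_minus_sqrt3_eq)
    moreover have "1 / (3 + alpha) \<le> 2972 / 10000"
      using sqrt3_bounds by (simp add: alpha_def field_simps)
    ultimately show ?thesis using 3 unfolding s_def by (intro three) simp_all
  qed
qed

lemma bounded_cf_2_1_ge:
  assumes "x \<in> bounded_cf 2 1"
  shows "2 - sqrt 3 \<le> x"
  using assms sqrt3_bounds alpha_bounds by (cases rule: bounded_cf_2_1_cases) auto

lemma bounded_cf_2_1_sum_one_cases:
  assumes x: "x \<in> bounded_cf 2 1" and y: "y \<in> bounded_cf 2 1" and z: "z \<in> bounded_cf 2 1"
    and "x \<le> y" "y \<le> z" and sum: "x + y + z = 1"
  shows "x = 2 - sqrt 3 \<and> y = alpha \<and> z = alpha \<or>
    x = 1 / (3 + gauss_map x) \<and> y = 1 / (3 + gauss_map y) \<and> z = 1 / (2 + gauss_map z)"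
proof -
  have lower: "2 - sqrt 3 \<le> x" "2 - sqrt 3 \<le> y" "2 - sqrt 3 \<le> z"
    using bounded_cf_2_1_ge x y z by auto
  have numerics: "2679 / 10000 \<le> 2 - sqrt 3" "366 / 1000 \<le> alpha"
    using sqrt3_bounds alpha_bounds by simp_all
  have x3: "x = 1 / (3 + gauss_map x)"
    using x by (cases rule: bounded_cf_2_1_cases) (use assms lower numerics in linarith)+
  have z2: "alpha \<le> z \<and> z = 1 / (2 + gauss_map z)"
    using z
  proof (cases rule: bounded_cf_2_1_cases)
    case two
    then show ?thesis by simp
  qed (use assms lower numerics in linarith)+
  show ?thesis
    using y
  proof (cases rule: bounded_cf_2_1_cases)
    case one
    then show ?thesis using lower numerics sum by linarith
  next
    case two
    have "2 - sqrt 3 + alpha + alpha = 1" by (simp add: alpha_def)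
    then show ?thesis using two z2 lower sum by linarith
  next
    case three
    then show ?thesis using x3 z2 by blast
  qed
qed

lemma bounded_cf_2_1_sum_one_three_three_two:
  assumes x: "x \<in> bounded_cf 2 1" and y: "y \<in> bounded_cf 2 1" and z: "z \<in> bounded_cf 2 1"
    and digits: "x = 1 / (3 + gauss_map x)" "y = 1 / (3 + gauss_map y)" "z = 1 / (2 + gauss_map z)"
    and sum: "x + y + z = 1"
  shows "x = (2 - sqrt 2) / 2 \<and> y = (2 - sqrt 2) / 2 \<and> z = sqrt 2 - 1"
proof -
  define s t u where "s = gauss_map x" "t = gauss_map y" "u = gauss_map z"
  have stu: "s \<in> bounded_cf 2 0" "t \<in> bounded_cf 2 0" "u \<in> bounded_cf 2 0"
    using gauss_map_in_bounded_cf x y z unfolding s_t_u_def by fastforce+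
  then have "0 \<le> s" "0 \<le> t" "0 \<le> u" using bounded_cf_unit by (meson less_imp_le)+
  moreover have "1 / (3 + s) + 1 / (3 + t) + 1 / (2 + u) = 1"
    using sum digits unfolding s_t_u_def by simp
  ultimately have "(3 * sqrt 2 - 4) * defect kappa s t u = 0"
    using sum_eq_one_minus_defect by simp
  moreover have "3 * sqrt 2 - 4 \<noteq> 0" using sqrt2_bounds by simp
  ultimately have "s = omega \<and> t = omega \<and> u = omega"
    using defect_zero_imp_omega stu by simp
  then have "x = 1 / (3 + omega)" "y = 1 / (3 + omega)" "z = 1 / (2 + omega)"
    using digits unfolding s_t_u_def[symmetric] by simp_all
  then show ?thesis
    using half_two_minus_sqrt2_eq omega_fixed by (metis omega_def)
qed

lemma bounded_cf_2_1_sum_one_solutions: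
  assumes xyz: "x \<in> bounded_cf 2 1" "y \<in> bounded_cf 2 1" "z \<in> bounded_cf 2 1"
    and "x \<le> y" "y \<le> z" "x + y + z = 1"
  shows "(x, y, z) \<in> {(2 - sqrt 3, (sqrt 3 - 1) / 2, (sqrt 3 - 1) / 2),
                        ((2 - sqrt 2) / 2, (2 - sqrt 2) / 2, sqrt 2 - 1)}"
  using bounded_cf_2_1_sum_one_cases[OF assms]
    bounded_cf_2_1_sum_one_three_three_two[OF xyz _ _ _ \<open>x + y + z = 1\<close>]
  by (auto simp: alpha_def)

lemma solutions_in_bounded_cf_2_1:
  "2 - sqrt 3 \<in> bounded_cf 2 1" "(sqrt 3 - 1) / 2 \<in> bounded_cf 2 1"
  "(2 - sqrt 2) / 2 \<in> bounded_cf 2 1" "sqrt 2 - 1 \<in> bounded_cf 2 1"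
proof -
  show "(sqrt 3 - 1) / 2 \<in> bounded_cf 2 1" "sqrt 2 - 1 \<in> bounded_cf 2 1"
    using alpha_beta_in_bounded_cf omega_in_bounded_cf bounded_cf_mono[of 0 1 2]
    by (auto simp: alpha_def omega_def)
  have "1 / (of_int 3 + beta) \<in> bounded_cf 2 1" "1 / (of_int 3 + omega) \<in> bounded_cf 2 1"
    using bounded_cf_inverse_add[of beta 2 1 3] bounded_cf_inverse_add[of omega 2 1 3]
      alpha_beta_in_bounded_cf omega_in_bounded_cf by simp_all
  then show "2 - sqrt 3 \<in> bounded_cf 2 1" "(2 - sqrt 2) / 2 \<in> bounded_cf 2 1"
    by (simp_all add: two_minus_sqrt3_eq half_two_minus_sqrt2_eq)
qed

theorem mainTheorem6:
  shows "{(x, y, z). x \<in> bounded_cf 2 1 \<and> y \<in> bounded_cf 2 1 \<and> z \<in> bounded_cf 2 1 \<and>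
            x \<le> y \<and> y \<le> z \<and> x + y + z = 1}
       = {(2 - sqrt 3, (sqrt 3 - 1) / 2, (sqrt 3 - 1) / 2),
          ((2 - sqrt 2) / 2, (2 - sqrt 2) / 2, sqrt 2 - 1)}" (is "?L = ?R")
proof
  show "?L \<subseteq> ?R"
    using bounded_cf_2_1_sum_one_solutions by blast
  have "2 - sqrt 3 \<le> (sqrt 3 - 1) / 2" "(2 - sqrt 2) / 2 \<le> sqrt 2 - 1"
    using sqrt3_bounds sqrt2_bounds by simp_all
  then show "?R \<subseteq> ?L"
    using solutions_in_bounded_cf_2_1 by auto
qed

end
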